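(* Let $G$ be a discrete group and $\sigma\in Z^2(G,\mathbb{T})$. Assume that $\kappa:G\to[1,\infty)$ is a proper map, that $(G,\sigma)$ is $\kappa$-decaying, and that every nontrivial $\sigma$-regular conjugacy class in $G$ has superpolynomial growth (w.r.t. $\kappa$). Then $(G,\sigma)$ has the unique trace property.
   Context: For a discrete group $G$ with identity $e$, $Z^2(G,\mathbb{T})$ is the set of normalized 2-cocycles, i.e. maps $\sigma:G\times G\to\mathbb{T}$ with $\sigma(g,e)=\sigma(e,g)=1$ and $\sigma(g,h)\sigma(gh,k)=\sigma(h,k)\sigma(g,hk)$ for all $g,h,k$. With $(\lambda_\sigma(g)\xi)(h)=\sigma(g,g^{-1}h)\xi(g^{-1}h)$ on $\ell^2(G)$, $C_r^*(G,\sigma)$ is the C$^*$-algebra generated by $\lambda_\sigma(G)$. $(G,\sigma)$ has the unique trace property if $C_r^*(G,\sigma)$ has a unique tracial state. An element $g\in G$ is $\sigma$-regular if $\sigma(g,h)=\sigma(h,g)$ whenever $h\in G$ commutes with $g$; this depends only on the conjugacy class of $g$, which is then called $\sigma$-regular. For $\kappa:G\to[1,\infty)$ and $\xi:G\to\mathbb{C}$, $\|\xi\|_{2,\kappa}=\big(\sum_{g\in G}|\xi(g)\kappa(g)|^2\big)^{1/2}\in[0,\infty]$. $(G,\sigma)$ is $\kappa$-decaying if there is $M>0$ such that $\|\sum_{g}f(g)\lambda_\sigma(g)\|\le M\|f\|_{2,\kappa}$ for every finitely supported $f:G\to\mathbb{C}$. The map $\kappa$ is proper if preimages of bounded sets are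 finite. A subset $C\subset G$ has superpolynomial growth (w.r.t. $\kappa$) if for every real polynomial $P$ there is an infinite subset $K\subset\mathbb{N}$ such that $|C_k|>P(k)$ for all $k\in K$, where $C_k=C\cap\{g\in G:k-1<\kappa(g)\le k\}$. *)

theory Defs
  imports "HOL-Analysis.Analysis"
begin

text \<open>
  Discrete groups are types of class \<^class>\<open>group_add\<close>. This class does not assume commutativity:
  the product is written \<open>g + h\<close>, the identity \<open>0\<close> and the inverse \<open>- g\<close>.
\<close>

section \<open>The Hilbert space of square-summable functions\<close>

typedef 'a ell2 = "{f :: 'a \<Rightarrow> complex. (\<lambda>x. (cmod (f x))\<^sup>2) summable_on UNIV}"
  by (rule exI[of _ "\<lambda>_. 0"]) simp

setup_lifting type_definition_ell2

lemma ell2_summable_add: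
  fixes f g :: "'a \<Rightarrow> complex"
  assumes "(\<lambda>x. (cmod (f x))\<^sup>2) summable_on UNIV" "(\<lambda>x. (cmod (g x))\<^sup>2) summable_on UNIV"
  shows "(\<lambda>x. (cmod (f x + g x))\<^sup>2) summable_on UNIV"
proof (rule summable_on_comparison_test)
  show "(\<lambda>x. 2 * (cmod (f x))\<^sup>2 + 2 * (cmod (g x))\<^sup>2) summable_on UNIV"
    by (intro summable_on_add summable_on_cmult_right assms)
  show "(cmod (f x + g x))\<^sup>2 \<le> 2 * (cmod (f x))\<^sup>2 + 2 * (cmod (g x))\<^sup>2" for x
  proof -
    have "(cmod (f x + g x))\<^sup>2 \<le> (cmod (f x) + cmod (g x))\<^sup>2"
      by (intro power_mono norm_triangle_ineq) auto
    also have "\<dots> \<le> 2 * (cmod (f x))\<^sup>2 + 2 * (cmod (g x))\<^sup>2"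
      using sum_squares_bound[of "cmod (f x)" "cmod (g x)"] by (simp add: power2_sum)
    finally show ?thesis .
  qed
qed simp

lemma ell2_summable_scale:
  fixes f :: "'a \<Rightarrow> complex"
  assumes "(\<lambda>x. (cmod (f x))\<^sup>2) summable_on UNIV"
  shows "(\<lambda>x. (cmod (c * f x))\<^sup>2) summable_on UNIV"
  using summable_on_cmult_right[OF assms, of "(cmod c)\<^sup>2"]
  by (simp add: norm_mult power_mult_distrib)

lemma ell2_summable_inner:
  fixes f g :: "'a \<Rightarrow> complex"
  assumes "(\<lambda>x. (cmod (f x))\<^sup>2) summable_on UNIV" "(\<lambda>x. (cmod (g x))\<^sup>2) summable_on UNIV"
  shows "(\<lambda>x. f x * cnj (g x)) summable_on UNIV"
proof -
  have "(\<lambda>x. norm (f x * cnj (g x))) summable_on UNIV"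
  proof (rule summable_on_comparison_test)
    show "(\<lambda>x. (cmod (f x))\<^sup>2 + (cmod (g x))\<^sup>2) summable_on UNIV"
      by (intro summable_on_add assms)
    show "norm (f x * cnj (g x)) \<le> (cmod (f x))\<^sup>2 + (cmod (g x))\<^sup>2" for x
    proof -
      have "2 * (cmod (f x) * cmod (g x)) \<le> (cmod (f x))\<^sup>2 + (cmod (g x))\<^sup>2"
        using sum_squares_bound[of "cmod (f x)" "cmod (g x)"] by (simp add: mult.assoc)
      moreover have "0 \<le> cmod (f x) * cmod (g x)"
        by simp
      ultimately show ?thesis
        unfolding norm_mult complex_mod_cnj by linarith
    qed
  qed simp
  then show ?thesis
    by (rule abs_summable_summable)
qed

instantiation ell2 :: (type) real_vector
begin

lift_definition zero_ell2 :: "'a ell2" is "\<lambda>_. 0" by simp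
lift_definition plus_ell2 :: "'a ell2 \<Rightarrow> 'a ell2 \<Rightarrow> 'a ell2" is "\<lambda>f g x. f x + g x"
  by (rule ell2_summable_add)
lift_definition uminus_ell2 :: "'a ell2 \<Rightarrow> 'a ell2" is "\<lambda>f x. - f x" by simp
lift_definition minus_ell2 :: "'a ell2 \<Rightarrow> 'a ell2 \<Rightarrow> 'a ell2" is "\<lambda>f g x. f x - g x"
  subgoal for f g using ell2_summable_add[of f "\<lambda>x. - g x"] by simp
  done
lift_definition scaleR_ell2 :: "real \<Rightarrow> 'a ell2 \<Rightarrow> 'a ell2" is "\<lambda>r f x. r *\<^sub>R f x"
  unfolding scaleR_conv_of_real by (rule ell2_summable_scale)

instance
  by standard (transfer; simp add: algebra_simps; fail)+

end

lift_definition scaleC_ell2 :: "complex \<Rightarrow> 'a ell2 \<Rightarrow> 'a ell2"  (infixr \<open>*\<^sub>C\<close> 75)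
  is "\<lambda>c f x. c * f x"
  by (rule ell2_summable_scale)

text \<open>Linear in the first argument.\<close>

lift_definition cinner_ell2 :: "'a ell2 \<Rightarrow> 'a ell2 \<Rightarrow> complex"
  is "\<lambda>f g. \<Sum>\<^sub>\<infinity>x. f x * cnj (g x)" .

instantiation ell2 :: (type) real_inner
begin

lift_definition norm_ell2 :: "'a ell2 \<Rightarrow> real" is "\<lambda>f. sqrt (\<Sum>\<^sub>\<infinity>x. (cmod (f x))\<^sup>2)" .

definition inner_ell2 :: "'a ell2 \<Rightarrow> 'a ell2 \<Rightarrow> real"
  where "inner_ell2 \<xi> \<eta> = Re (cinner_ell2 \<xi> \<eta>)"
definition dist_ell2 :: "'a ell2 \<Rightarrow> 'a ell2 \<Rightarrow> real"
  where "dist_ell2 \<xi> \<eta> = norm (\<xi> - \<eta>)"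
definition sgn_ell2 :: "'a ell2 \<Rightarrow> 'a ell2"
  where "sgn_ell2 \<xi> = \<xi> /\<^sub>R norm \<xi>"
definition uniformity_ell2 :: "('a ell2 \<times> 'a ell2) filter"
  where "uniformity_ell2 = (INF e\<in>{0<..}. principal {(x, y). dist x y < e})"
definition open_ell2 :: "'a ell2 set \<Rightarrow> bool"
  where "open_ell2 U \<longleftrightarrow> (\<forall>x\<in>U. \<forall>\<^sub>F (x', y) in uniformity. x' = x \<longrightarrow> y \<in> U)"

instance
proof
  fix x y z :: "'a ell2" and r :: real and U :: "'a ell2 set"
  have self: "inner u u = (\<Sum>\<^sub>\<infinity>i. (cmod (Rep_ell2 u i))\<^sup>2)" for u :: "'a ell2"
  proof -
    have "cinner_ell2 u u = (\<Sum>\<^sub>\<infinity>i. of_real ((cmod (Rep_ell2 u i))\<^sup>2))"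
      by transfer (simp add: complex_norm_square del: of_real_power)
    also have "\<dots> = of_real (\<Sum>\<^sub>\<infinity>i. (cmod (Rep_ell2 u i))\<^sup>2)"
      using Rep_ell2[of u] by (intro infsumI has_sum_of_real has_sum_infsum) simp
    finally show ?thesis
      by (simp add: inner_ell2_def)
  qed
  show "dist x y = norm (x - y)"
    by (rule dist_ell2_def)
  show "sgn x = x /\<^sub>R norm x"
    by (rule sgn_ell2_def)
  show "uniformity = (INF e\<in>{0<..}. principal {(x :: 'a ell2, y). dist x y < e})"
    by (rule uniformity_ell2_def)
  show "open U \<longleftrightarrow> (\<forall>x\<in>U. \<forall>\<^sub>F (x', y) in uniformity. x' = x \<longrightarrow> y \<in> U)"
    by (rule open_ell2_def)
  have "cinner_ell2 y x = cnj (cinner_ell2 x y)"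
    by transfer (simp flip: infsum_cnj add: mult.commute)
  then show "inner x y = inner y x"
    by (simp add: inner_ell2_def)
  have "cinner_ell2 (x + y) z = cinner_ell2 x z + cinner_ell2 y z"
    by transfer (simp add: distrib_right infsum_add ell2_summable_inner)
  then show "inner (x + y) z = inner x z + inner y z"
    by (simp add: inner_ell2_def)
  have "cinner_ell2 (r *\<^sub>R x) y = of_real r * cinner_ell2 x y"
    by transfer (simp add: scaleR_conv_of_real mult.assoc infsum_cmult_right')
  then show "inner (r *\<^sub>R x) y = r * inner x y"
    by (simp add: inner_ell2_def)
  show "0 \<le> inner x x"
    unfolding self by (rule infsum_nonneg) simp
  show "inner x x = 0 \<longleftrightarrow> x = 0"
  proof
    assume "inner x x = 0"
    then have "(cmod (Rep_ell2 x i))\<^sup>2 = 0" for i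
      using Rep_ell2[of x] unfolding self
      by (intro nonneg_infsum_le_0D[where A = UNIV]) auto
    then show "x = 0"
      by transfer auto
  next
    assume "x = 0"
    then show "inner x x = 0"
      by (simp add: self zero_ell2.rep_eq)
  qed
  show "norm x = sqrt (inner x x)"
    unfolding self by transfer simp
qed

end


section \<open>C*-algebras of operators, traces and states\<close>

text \<open>
  \<^typ>\<open>'a ell2 \<Rightarrow>\<^sub>L 'a ell2\<close> is the space of bounded real-linear operators with the operator norm;
  the bounded operators on the complex Hilbert space are its complex-linear elements.
\<close>

type_synonym 'a op = "'a ell2 \<Rightarrow>\<^sub>L 'a ell2"

definition clinear_op :: "'a op \<Rightarrow> bool"
  where "clinear_op T \<longleftrightarrow> (\<forall>c \<xi>. blinfun_apply T (c *\<^sub>C \<xi>) = c *\<^sub>C blinfun_apply T \<xi>)"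

lemma norm_scaleC_ell2: "norm (c *\<^sub>C \<xi>) = cmod c * norm \<xi>"
  by transfer (simp add: norm_mult power_mult_distrib infsum_cmult_right' real_sqrt_mult)

lift_definition mult_op :: "complex \<Rightarrow> 'a op" is "\<lambda>c \<xi>. c *\<^sub>C \<xi>"
proof (rule bounded_linear_intro)
  fix c r :: complex and s :: real and \<xi> \<eta> :: "'a ell2"
  show "c *\<^sub>C (\<xi> + \<eta>) = c *\<^sub>C \<xi> + c *\<^sub>C \<eta>"
    by transfer (simp add: algebra_simps)
  show "c *\<^sub>C (s *\<^sub>R \<xi>) = s *\<^sub>R (c *\<^sub>C \<xi>)"
    by transfer (simp add: algebra_simps)
  show "norm (c *\<^sub>C \<xi>) \<le> norm \<xi> * cmod c"
    by (simp add: norm_scaleC_ell2)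
qed

definition scaleC_op :: "complex \<Rightarrow> 'a op \<Rightarrow> 'a op"
  where "scaleC_op c T = mult_op c o\<^sub>L T"

text \<open>
  \<open>is_adjoint T T'\<close> says \<open>T' = T\<^sup>*\<close>: every complex-linear bounded operator has exactly one adjoint.
\<close>

definition is_adjoint :: "'a op \<Rightarrow> 'a op \<Rightarrow> bool"
  where "is_adjoint T T' \<longleftrightarrow>
    (\<forall>\<xi> \<eta>. cinner_ell2 (blinfun_apply T \<xi>) \<eta> = cinner_ell2 \<xi> (blinfun_apply T' \<eta>))"

definition cstar_subalgebra :: "'a op set \<Rightarrow> bool"
  where "cstar_subalgebra A \<longleftrightarrow>
    (\<forall>S\<in>A. clinear_op S) \<and>
    0 \<in> A \<and>
    (\<forall>S\<in>A. \<forall>T\<in>A. S + T \<in> A) \<and>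
    (\<forall>c. \<forall>S\<in>A. scaleC_op c S \<in> A) \<and>
    (\<forall>S\<in>A. \<forall>T\<in>A. S o\<^sub>L T \<in> A) \<and>
    (\<forall>S\<in>A. \<forall>S'. is_adjoint S S' \<longrightarrow> S' \<in> A) \<and>
    closed A"

definition cstar_generated :: "'a op set \<Rightarrow> 'a op set"
  where "cstar_generated S = \<Inter>{A. cstar_subalgebra A \<and> S \<subseteq> A}"

definition linear_functional_on :: "'a op set \<Rightarrow> ('a op \<Rightarrow> complex) \<Rightarrow> bool"
  where "linear_functional_on A \<phi> \<longleftrightarrow>
    (\<forall>S\<in>A. \<forall>T\<in>A. \<phi> (S + T) = \<phi> S + \<phi> T) \<and>
    (\<forall>c. \<forall>S\<in>A. \<phi> (scaleC_op c S) = c * \<phi> S)"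

definition functional_norm :: "'a op set \<Rightarrow> ('a op \<Rightarrow> complex) \<Rightarrow> ennreal"
  where "functional_norm A \<phi> = (SUP T\<in>{T\<in>A. norm T \<le> 1}. ennreal (cmod (\<phi> T)))"

definition state_on :: "'a op set \<Rightarrow> ('a op \<Rightarrow> complex) \<Rightarrow> bool"
  where "state_on A \<phi> \<longleftrightarrow>
    linear_functional_on A \<phi> \<and>
    (\<forall>S\<in>A. \<forall>S'. is_adjoint S S' \<longrightarrow> \<phi> (S' o\<^sub>L S) \<in> \<real>\<^sub>\<ge>\<^sub>0) \<and>
    functional_norm A \<phi> = 1"

text \<open>
  Membership in \<^term>\<open>extensional A\<close> fixes the irrelevant values outside \<open>A\<close>, so that equality of
  tracial states is equality of functions on \<open>A\<close>.
\<close>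

definition tracial_state_on :: "'a op set \<Rightarrow> ('a op \<Rightarrow> complex) \<Rightarrow> bool"
  where "tracial_state_on A \<tau> \<longleftrightarrow>
    \<tau> \<in> extensional A \<and> state_on A \<tau> \<and> (\<forall>S\<in>A. \<forall>T\<in>A. \<tau> (S o\<^sub>L T) = \<tau> (T o\<^sub>L S))"


section \<open>Cocycles and reduced twisted group C*-algebras\<close>

definition two_cocycle :: "('g::group_add \<Rightarrow> 'g \<Rightarrow> complex) \<Rightarrow> bool"
  where "two_cocycle \<sigma> \<longleftrightarrow>
    (\<forall>g h. cmod (\<sigma> g h) = 1) \<and>
    (\<forall>g. \<sigma> g 0 = 1 \<and> \<sigma> 0 g = 1) \<and>
    (\<forall>g h k. \<sigma> g h * \<sigma> (g + h) k = \<sigma> h k * \<sigma> g (h + k))"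

text \<open>
  The uses of \<^const>\<open>Abs_ell2\<close> and \<^const>\<open>Blinfun\<close> are justified by \<open>lambda_op_apply\<close> below.
\<close>

definition lambda_op :: "('g::group_add \<Rightarrow> 'g \<Rightarrow> complex) \<Rightarrow> 'g \<Rightarrow> 'g op"
  where "lambda_op \<sigma> g =
    Blinfun (\<lambda>\<xi>. Abs_ell2 (\<lambda>h. \<sigma> g (- g + h) * Rep_ell2 \<xi> (- g + h)))"

lemma lambda_op_apply:
  fixes \<sigma> :: "'g::group_add \<Rightarrow> 'g \<Rightarrow> complex"
  assumes "two_cocycle \<sigma>"
  shows "Rep_ell2 (blinfun_apply (lambda_op \<sigma> g) \<xi>) h = \<sigma> g (- g + h) * Rep_ell2 \<xi> (- g + h)"
proof -
  define L where "L \<xi> = (\<lambda>h. \<sigma> g (- g + h) * Rep_ell2 \<xi> (- g + h))" for \<xi>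
  have unit: "cmod (\<sigma> a b) = 1" for a b
    using assms by (simp add: two_cocycle_def)
  have bij: "bij_betw (\<lambda>h. - g + h) UNIV UNIV"
    by (rule bij_betw_byWitness[where f' = "\<lambda>h. g + h"]) (auto simp: add.assoc[symmetric])
  have eq: "(\<lambda>h. (cmod (L \<xi> h))\<^sup>2) = (\<lambda>h. (cmod (Rep_ell2 \<xi> (- g + h)))\<^sup>2)" for \<xi>
    by (simp add: L_def norm_mult unit)
  have mem: "L \<xi> \<in> {f. (\<lambda>x. (cmod (f x))\<^sup>2) summable_on UNIV}" for \<xi>
    using Rep_ell2[of \<xi>] summable_on_reindex_bij_betw[OF bij, of "\<lambda>h. (cmod (Rep_ell2 \<xi> h))\<^sup>2"]
    by (simp add: eq)
  note rep = Abs_ell2_inverse[OF mem]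
  have norm: "norm (Abs_ell2 (L \<xi>)) = norm \<xi>" for \<xi>
    using infsum_reindex_bij_betw[OF bij, of "\<lambda>h. (cmod (Rep_ell2 \<xi> h))\<^sup>2"]
    by (simp add: norm_ell2.rep_eq rep eq)
  have "bounded_linear (\<lambda>\<xi>. Abs_ell2 (L \<xi>))"
  proof (rule bounded_linear_intro[where K = 1])
    show "Abs_ell2 (L (\<xi> + \<eta>)) = Abs_ell2 (L \<xi>) + Abs_ell2 (L \<eta>)" for \<xi> \<eta>
      by (intro Rep_ell2_inject[THEN iffD1] ext)
        (simp add: rep plus_ell2.rep_eq, simp add: L_def plus_ell2.rep_eq algebra_simps)
    show "Abs_ell2 (L (r *\<^sub>R \<xi>)) = r *\<^sub>R Abs_ell2 (L \<xi>)" for r \<xi>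
      by (intro Rep_ell2_inject[THEN iffD1] ext)
        (simp add: rep scaleR_ell2.rep_eq, simp add: L_def scaleR_ell2.rep_eq)
  qed (simp add: norm)
  then show ?thesis
    unfolding lambda_op_def L_def[symmetric]
    by (simp add: bounded_linear_Blinfun_apply rep) (simp add: L_def)
qed

definition reduced_twisted_cstar :: "('g::group_add \<Rightarrow> 'g \<Rightarrow> complex) \<Rightarrow> 'g op set"
  where "reduced_twisted_cstar \<sigma> = cstar_generated (range (lambda_op \<sigma>))"

definition unique_trace_property :: "('g::group_add \<Rightarrow> 'g \<Rightarrow> complex) \<Rightarrow> bool"
  where "unique_trace_property \<sigma> \<longleftrightarrow> (\<exists>!\<tau>. tracial_state_on (reduced_twisted_cstar \<sigma>) \<tau>)"


section \<open>Regular conjugacy classes, decay and growth\<close>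

definition conj_class :: "'g::group_add \<Rightarrow> 'g set"
  where "conj_class g = range (\<lambda>h. h + g - h)"

definition regular_element :: "('g::group_add \<Rightarrow> 'g \<Rightarrow> complex) \<Rightarrow> 'g \<Rightarrow> bool"
  where "regular_element \<sigma> g \<longleftrightarrow> (\<forall>h. g + h = h + g \<longrightarrow> \<sigma> g h = \<sigma> h g)"

definition regular_conj_class :: "('g::group_add \<Rightarrow> 'g \<Rightarrow> complex) \<Rightarrow> 'g set \<Rightarrow> bool"
  where "regular_conj_class \<sigma> C \<longleftrightarrow> (\<exists>g. C = conj_class g \<and> regular_element \<sigma> g)"

text \<open>The value is \<open>\<infinity>\<close> for families that are not square-summable.\<close>

definition weighted_norm :: "('g \<Rightarrow> real) \<Rightarrow> ('g \<Rightarrow> complex) \<Rightarrow> ennreal"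
  where "weighted_norm \<kappa> \<xi> =
    (if (\<lambda>g. (cmod (\<xi> g * of_real (\<kappa> g)))\<^sup>2) summable_on UNIV
     then ennreal (sqrt (\<Sum>\<^sub>\<infinity>g. (cmod (\<xi> g * of_real (\<kappa> g)))\<^sup>2)) else \<infinity>)"

definition decaying :: "('g::group_add \<Rightarrow> 'g \<Rightarrow> complex) \<Rightarrow> ('g \<Rightarrow> real) \<Rightarrow> bool"
  where "decaying \<sigma> \<kappa> \<longleftrightarrow> (\<exists>M>0. \<forall>f. finite {g. f g \<noteq> 0} \<longrightarrow>
    ennreal (norm (\<Sum>g\<in>{g. f g \<noteq> 0}. scaleC_op (f g) (lambda_op \<sigma> g)))
      \<le> ennreal M * weighted_norm \<kappa> f)"

definition proper_weight :: "('g \<Rightarrow> real) \<Rightarrow> bool"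
  where "proper_weight \<kappa> \<longleftrightarrow> (\<forall>B. bounded B \<longrightarrow> finite (\<kappa> -` B))"

text \<open>
  The annuli are finite for proper \<open>\<kappa>\<close>; for other weights \<^const>\<open>card\<close> would be 0 on infinite ones.
\<close>

definition superpolynomial_growth :: "('g \<Rightarrow> real) \<Rightarrow> 'g set \<Rightarrow> bool"
  where "superpolynomial_growth \<kappa> C \<longleftrightarrow> (\<forall>P :: real poly. \<exists>K :: nat set. infinite K \<and>
    (\<forall>k\<in>K. real (card (C \<inter> {g. real k - 1 < \<kappa> g \<and> \<kappa> g \<le> real k})) > poly P (real k)))"

end

theory Submission
  imports Defs
begin

text \<open>
  Write \<open>A\<close> for the reduced twisted group C*-algebra and let \<open>\<tau>\<close> be a tracial state on it. Everything
  rests on the claim that \<open>\<tau>(\<lambda>(g)) = 0\<close> for every \<open>g\<close> other than the identity: since \<open>\<tau>\<close> is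
  continuous and unital and the multiples of the unitaries \<open>\<lambda>(g)\<close> span a dense subspace, the claim
  determines \<open>\<tau>\<close> (\<open>tracial_state_eqI\<close>), while the vector state of the point mass at the identity is
  a tracial state (\<open>canonical_trace\<close>).

  If \<open>g\<close> is not \<open>\<sigma>\<close>-regular, some \<open>h\<close> commutes with \<open>g\<close> although \<open>\<lambda>(h) \<lambda>(g) \<lambda>(h)\<^sup>*\<close> is a multiple of
  \<open>\<lambda>(g)\<close> by a scalar other than \<open>1\<close>; invariance of \<open>\<tau>\<close> under conjugation forces \<open>\<tau>(\<lambda>(g)) = 0\<close>
  (\<open>trace_nonregular\<close>).

  If \<open>g\<close> is regular, let \<open>F\<close> be the part of its conjugacy class in the annulus
  \<open>k - 1 < \<kappa> \<le> k\<close>. Invariance under conjugation provides unimodular \<open>c x\<close> with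
  \<open>c x * \<tau>(\<lambda>(x)) = \<tau>(\<lambda>(g))\<close> for \<open>x \<in> F\<close> (\<open>trace_conj_class\<close>), so the value of \<open>\<tau>\<close> at
  \<open>S = (\<Sum>x\<in>F. c x * \<lambda>(x))\<close> is \<open>\<bar>F\<bar> \<tau>(\<lambda>(g))\<close>. Since \<open>\<tau>\<close> is contractive, \<open>\<kappa>\<close>-decay yields
  \<open>\<bar>F\<bar> * \<bar>\<tau>(\<lambda>(g))\<bar> \<le> \<parallel>S\<parallel> \<le> M k \<bar>F\<bar>\<^sup>1\<^sup>/\<^sup>2\<close>. Thus, were \<open>\<tau>(\<lambda>(g))\<close> nonzero, \<open>\<bar>F\<bar>\<close> would be at most
  \<open>M\<^sup>2 k\<^sup>2 / \<bar>\<tau>(\<lambda>(g))\<bar>\<^sup>2\<close> for every \<open>k\<close>, contrary to superpolynomial growth (\<open>trace_regular\<close>).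
\<close>


section \<open>Operators and adjoints\<close>

lemma op_eqI:
  assumes "\<And>\<xi> x. Rep_ell2 (blinfun_apply S \<xi>) x = Rep_ell2 (blinfun_apply T \<xi>) x"
  shows "S = T"
  by (intro blinfun_eqI Rep_ell2_inject[THEN iffD1] ext assms)

lemma scaleC_op_apply: "blinfun_apply (scaleC_op c T) \<xi> = c *\<^sub>C blinfun_apply T \<xi>"
  by (simp add: scaleC_op_def mult_op.rep_eq)

lemma Rep_scaleC_op: "Rep_ell2 (blinfun_apply (scaleC_op c T) \<xi>) x = c * Rep_ell2 (blinfun_apply T \<xi>) x"
  by (simp add: scaleC_op_apply scaleC_ell2.rep_eq)

lemma scaleC_op_of_real: "scaleC_op (of_real r) T = r *\<^sub>R T"
  by (rule op_eqI)
    (simp add: Rep_scaleC_op blinfun.scaleR_left scaleR_ell2.rep_eq scaleR_conv_of_real)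

lemma scaleC_op_one [simp]: "scaleC_op 1 T = T"
  using scaleC_op_of_real[of 1 T] by simp

lemma scaleC_op_minus_one [simp]: "scaleC_op (- 1) T = - T"
  using scaleC_op_of_real[of "- 1" T] by simp

lemma scaleC_op_scaleC_op [simp]: "scaleC_op c (scaleC_op d T) = scaleC_op (c * d) T"
  by (rule op_eqI) (simp add: Rep_scaleC_op mult.assoc)

lemma scaleC_op_compose_left: "scaleC_op c S o\<^sub>L T = scaleC_op c (S o\<^sub>L T)"
  by (rule op_eqI) (simp add: Rep_scaleC_op)

lemma scaleC_op_compose_right:
  assumes "clinear_op S"
  shows "S o\<^sub>L scaleC_op c T = scaleC_op c (S o\<^sub>L T)"
  using assms by (intro blinfun_eqI) (simp add: scaleC_op_apply clinear_op_def)

lemma blinfun_compose_assoc: "(S o\<^sub>L T) o\<^sub>L U = S o\<^sub>L (T o\<^sub>L U)"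
  by (rule blinfun_eqI) simp

lemma scaleC_op_add: "scaleC_op c (S + T) = scaleC_op c S + scaleC_op c T"
  by (rule op_eqI) (simp add: Rep_scaleC_op blinfun.add_left plus_ell2.rep_eq algebra_simps)

lemma scaleC_op_scaleR: "scaleC_op c (r *\<^sub>R T) = r *\<^sub>R scaleC_op c T"
  by (simp flip: scaleC_op_of_real add: mult.commute)

lemma scaleC_op_zero [simp]: "scaleC_op c 0 = 0"
  by (simp add: scaleC_op_def bounded_bilinear.zero_right[OF bounded_bilinear_blinfun_compose])

text \<open>
  Complex linearity is commutation with all scalar operators, an equation between continuous
  functions of the operator; hence it survives norm limits.
\<close>

lemma clinear_op_iff_commute: "clinear_op T \<longleftrightarrow> (\<forall>c. T o\<^sub>L mult_op c = mult_op c o\<^sub>L T)"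
proof
  show "clinear_op T \<Longrightarrow> \<forall>c. T o\<^sub>L mult_op c = mult_op c o\<^sub>L T"
    by (auto intro!: blinfun_eqI simp: clinear_op_def mult_op.rep_eq)
  assume *: "\<forall>c. T o\<^sub>L mult_op c = mult_op c o\<^sub>L T"
  show "clinear_op T"
    unfolding clinear_op_def
  proof (intro allI)
    fix c \<xi>
    from * have "blinfun_apply (T o\<^sub>L mult_op c) \<xi> = blinfun_apply (mult_op c o\<^sub>L T) \<xi>"
      by simp
    then show "blinfun_apply T (c *\<^sub>C \<xi>) = c *\<^sub>C blinfun_apply T \<xi>"
      by (simp add: mult_op.rep_eq)
  qed
qed

lemma closed_clinear_op: "closed {T. clinear_op T}"
  unfolding clinear_op_iff_commute
  by (intro closed_Collect_all closed_Collect_eq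
      bounded_bilinear.continuous_on[OF bounded_bilinear_blinfun_compose] continuous_intros)

lemma subspace_clinear_op: "subspace {T :: 'a op. clinear_op T}"
proof -
  note bil = bounded_bilinear_blinfun_compose
  show ?thesis
    unfolding clinear_op_iff_commute
    by (rule subspaceI)
      (simp_all add: bounded_bilinear.zero_left[OF bil] bounded_bilinear.zero_right[OF bil]
        bounded_bilinear.add_left[OF bil] bounded_bilinear.add_right[OF bil]
        bounded_bilinear.scaleR_left[OF bil] bounded_bilinear.scaleR_right[OF bil])
qed

lemma cinner_ell2_cnj: "cinner_ell2 \<eta> \<xi> = cnj (cinner_ell2 \<xi> \<eta>)"
  by transfer (simp flip: infsum_cnj add: mult.commute)

lemma cinner_ell2_add_left: "cinner_ell2 (\<xi> + \<eta>) \<zeta> = cinner_ell2 \<xi> \<zeta> + cinner_ell2 \<eta> \<zeta>"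
  by transfer (simp add: distrib_right infsum_add ell2_summable_inner)

lemma cinner_ell2_scaleC_left: "cinner_ell2 (c *\<^sub>C \<xi>) \<eta> = c * cinner_ell2 \<xi> \<eta>"
  by transfer (simp add: mult.assoc infsum_cmult_right')

lemma cinner_ell2_add_right: "cinner_ell2 \<zeta> (\<xi> + \<eta>) = cinner_ell2 \<zeta> \<xi> + cinner_ell2 \<zeta> \<eta>"
  by (subst (1 2 3) cinner_ell2_cnj) (simp add: cinner_ell2_add_left)

lemma cinner_ell2_scaleC_right: "cinner_ell2 \<xi> (c *\<^sub>C \<eta>) = cnj c * cinner_ell2 \<xi> \<eta>"
  by (subst (1 2) cinner_ell2_cnj) (simp add: cinner_ell2_scaleC_left)

lemma cinner_ell2_self: "cinner_ell2 \<xi> \<xi> = of_real ((norm \<xi>)\<^sup>2)"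
proof (rule complex_eqI)
  show "Re (cinner_ell2 \<xi> \<xi>) = Re (of_real ((norm \<xi>)\<^sup>2))"
    by (simp add: power2_norm_eq_inner inner_ell2_def)
  show "Im (cinner_ell2 \<xi> \<xi>) = Im (of_real ((norm \<xi>)\<^sup>2))"
    using arg_cong[OF cinner_ell2_cnj[of \<xi> \<xi>], of Im] by simp
qed

lemma is_adjoint_sym: "is_adjoint S S' \<Longrightarrow> is_adjoint S' S"
  unfolding is_adjoint_def by (metis cinner_ell2_cnj)

lemma is_adjoint_zero: "is_adjoint 0 0"
proof -
  have "cinner_ell2 0 \<eta> = 0" "cinner_ell2 \<xi> 0 = 0" for \<xi> \<eta> :: "'a ell2"
    by (transfer, simp)+
  then show ?thesis
    by (simp add: is_adjoint_def)
qed

lemma is_adjoint_add: "is_adjoint S S' \<Longrightarrow> is_adjoint T T' \<Longrightarrow> is_adjoint (S + T) (S' + T')"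
  by (simp add: is_adjoint_def blinfun.add_left cinner_ell2_add_left cinner_ell2_add_right)

lemma is_adjoint_scaleC: "is_adjoint S S' \<Longrightarrow> is_adjoint (scaleC_op c S) (scaleC_op (cnj c) S')"
  by (simp add: is_adjoint_def scaleC_op_apply cinner_ell2_scaleC_left cinner_ell2_scaleC_right)

lemma is_adjoint_diff:
  assumes "is_adjoint S S'" "is_adjoint T T'"
  shows "is_adjoint (S - T) (S' - T')"
  using is_adjoint_add[OF assms(1) is_adjoint_scaleC[OF assms(2), of "- 1"]] by simp

text \<open>
  \<open>\<parallel>S\<^sup>* \<eta>\<parallel>\<^sup>2 = Re \<langle>S S\<^sup>* \<eta>, \<eta>\<rangle> \<le> \<parallel>S\<parallel> \<parallel>S\<^sup>* \<eta>\<parallel> \<parallel>\<eta>\<parallel>\<close>. Consequently an adjoint of a norm limit is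
  automatically the norm limit of the adjoints, so that the closure of a *-algebra can be treated
  without constructing adjoints by the Riesz representation theorem.
\<close>

lemma is_adjoint_norm_le:
  assumes "is_adjoint S S'"
  shows "norm S' \<le> norm S"
proof (rule norm_blinfun_bound)
  fix \<eta>
  let ?u = "blinfun_apply S' \<eta>"
  have "(norm ?u)\<^sup>2 = inner (blinfun_apply S ?u) \<eta>"
    using assms by (simp add: power2_norm_eq_inner inner_ell2_def is_adjoint_def)
  also have "\<dots> \<le> norm (blinfun_apply S ?u) * norm \<eta>"
    by (rule norm_cauchy_schwarz)
  also have "\<dots> \<le> norm S * norm ?u * norm \<eta>"
    by (intro mult_right_mono norm_blinfun) simp
  finally have "norm ?u * norm ?u \<le> (norm S * norm \<eta>) * norm ?u"
    by (simp add: power2_eq_square mult_ac)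
  then show "norm ?u \<le> norm S * norm \<eta>"
    by (cases "norm ?u = 0") (auto simp: mult_le_cancel_right)
qed simp


section \<open>States\<close>

lemma cstar_subalgebra_subspace:
  assumes "cstar_subalgebra A"
  shows "subspace A"
  using assms unfolding cstar_subalgebra_def
  by (intro subspaceI) (auto simp flip: scaleC_op_of_real)

lemma linear_functional_on_diff:
  assumes "cstar_subalgebra A" "linear_functional_on A \<phi>" "S \<in> A" "T \<in> A"
  shows "\<phi> (S - T) = \<phi> S - \<phi> T"
proof -
  have neg: "scaleC_op (- 1) T \<in> A"
    using assms(1,4) unfolding cstar_subalgebra_def by blast
  have "\<phi> (S + scaleC_op (- 1) T) = \<phi> S + \<phi> (scaleC_op (- 1) T)"
    using assms(2,3) neg unfolding linear_functional_on_def by blast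
  moreover have "\<phi> (scaleC_op (- 1) T) = (- 1) * \<phi> T"
    using assms(2,4) unfolding linear_functional_on_def by blast
  ultimately show ?thesis
    by simp
qed

lemma linear_functional_on_sum:
  assumes A: "cstar_subalgebra A" and \<phi>: "linear_functional_on A \<phi>"
    and "finite F" and T: "\<And>x. T x \<in> A"
  shows "\<phi> (\<Sum>x\<in>F. scaleC_op (c x) (T x)) = (\<Sum>x\<in>F. c x * \<phi> (T x))"
  using \<open>finite F\<close>
proof (induction rule: finite_induct)
  case empty
  have "0 \<in> A"
    using A by (simp add: cstar_subalgebra_def)
  then show ?case
    using linear_functional_on_diff[OF A \<phi>, of 0 0] by simp
next
  case (insert x F)
  have scaled: "scaleC_op (c x) (T x) \<in> A" for x
    using A T by (simp add: cstar_subalgebra_def)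
  then have "(\<Sum>x\<in>F. scaleC_op (c x) (T x)) \<in> A"
    using cstar_subalgebra_subspace[OF A] by (simp add: subspace_sum)
  with insert scaled \<phi> T show ?case
    by (simp add: linear_functional_on_def)
qed

lemma state_on_bound:
  assumes A: "cstar_subalgebra A" and \<phi>: "state_on A \<phi>" and T: "T \<in> A"
  shows "cmod (\<phi> T) \<le> norm T"
proof (cases "T = 0")
  case True
  with linear_functional_on_diff[OF A _ T T, of \<phi>] \<phi> show ?thesis
    by (simp add: state_on_def)
next
  case False
  define r where "r = inverse (norm T)"
  have mem: "scaleC_op (of_real r) T \<in> A"
    using A T by (simp add: cstar_subalgebra_def)
  have "norm (scaleC_op (of_real r) T) \<le> 1"
    using False unfolding scaleC_op_of_real by (simp add: r_def)
  with mem have "ennreal (cmod (\<phi> (scaleC_op (of_real r) T))) \<le> functional_norm A \<phi>"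
    unfolding functional_norm_def by (intro SUP_upper) simp
  also have "\<dots> = ennreal 1"
    using \<phi> by (simp add: state_on_def)
  finally have "cmod (\<phi> (scaleC_op (of_real r) T)) \<le> 1"
    by (simp del: ennreal_1)
  moreover have "\<phi> (scaleC_op (of_real r) T) = of_real r * \<phi> T"
    using \<phi> T by (simp only: state_on_def linear_functional_on_def)
  moreover have "0 \<le> r"
    by (simp add: r_def)
  ultimately have "r * cmod (\<phi> T) \<le> 1"
    by (simp add: norm_mult)
  then show ?thesis
    using False by (simp add: r_def field_simps)
qed

lemma state_on_continuous:
  assumes A: "cstar_subalgebra A" and \<phi>: "state_on A \<phi>"
  shows "continuous_on A \<phi>"
proof (rule continuous_onI)
  fix U and e :: real
  assume *: "U \<in> A" "0 < e"
  show "\<exists>d>0. \<forall>S\<in>A. dist S U < d \<longrightarrow> dist (\<phi> S) (\<phi> U) \<le> e"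
  proof (intro exI[of _ e] conjI ballI impI)
    fix S assume S: "S \<in> A" "dist S U < e"
    have "cmod (\<phi> S - \<phi> U) = cmod (\<phi> (S - U))"
      using linear_functional_on_diff[OF A _ S(1) *(1)] \<phi> by (simp add: state_on_def)
    also have "\<dots> \<le> norm (S - U)"
      using cstar_subalgebra_subspace[OF A] S * by (intro state_on_bound[OF A \<phi>] subspace_diff)
    finally show "dist (\<phi> S) (\<phi> U) \<le> e"
      using S by (simp add: dist_norm)
  qed (use * in auto)
qed

text \<open>
  Positivity of \<open>\<phi>\<close> at \<open>(T - \<phi>(T))\<^sup>*(T - \<phi>(T))\<close>, combined with \<open>\<phi>(T\<^sup>*T) \<le> \<parallel>T\<parallel>\<^sup>2\<close>. The
  derivation of \<open>\<bar>\<phi>(T)\<bar>\<^sup>2 \<le> \<phi>(1) \<phi>(T\<^sup>*T)\<close> would use \<open>T - \<phi>(T) / \<phi>(1)\<close> instead, with the case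
  \<open>\<phi>(1) = 0\<close> apart; this variant avoids the quotient.
\<close>

lemma state_on_cauchy_schwarz:
  assumes A: "cstar_subalgebra A" and \<phi>: "state_on A \<phi>" and unit: "id_blinfun \<in> A"
    and T: "T \<in> A" and adj: "is_adjoint T T'"
  shows "(2 - Re (\<phi> id_blinfun)) * (cmod (\<phi> T))\<^sup>2 \<le> (norm T)\<^sup>2"
proof -
  have lin: "linear_functional_on A \<phi>"
    using \<phi> by (simp add: state_on_def)
  have T': "T' \<in> A"
    using A T adj unfolding cstar_subalgebra_def by blast
  have T'T: "T' o\<^sub>L T \<in> A"
    using A T T' unfolding cstar_subalgebra_def by blast
  have add: "\<phi> (S + U) = \<phi> S + \<phi> U" and add_mem: "S + U \<in> A" if "S \<in> A" "U \<in> A" for S U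
    using lin that A by (simp_all add: linear_functional_on_def cstar_subalgebra_def)
  have scale: "\<phi> (scaleC_op c S) = c * \<phi> S" and scale_mem: "scaleC_op c S \<in> A" if "S \<in> A" for c S
    using lin that A by (simp_all add: linear_functional_on_def cstar_subalgebra_def)
  have adj_id: "is_adjoint id_blinfun id_blinfun"
    by (simp add: is_adjoint_def)
  have clin: "clinear_op T'"
    using A T' unfolding cstar_subalgebra_def by blast
  define a b b' c where "a = \<phi> id_blinfun" and "b = \<phi> T" and "b' = \<phi> T'"
    and "c = \<phi> (T' o\<^sub>L T)"
  have "id_blinfun o\<^sub>L id_blinfun = (id_blinfun :: 'a op)"
    by (rule blinfun_eqI) simp
  then have "a \<in> \<real>\<^sub>\<ge>\<^sub>0"
    using \<phi> unit adj_id unfolding state_on_def a_def by metis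
  then have a: "a = of_real (Re a)"
    by (metis nonneg_Reals_cases Re_complex_of_real)
  have pos: "z * cnj z * a + cnj z * b + z * b' + c \<in> \<real>\<^sub>\<ge>\<^sub>0" for z
  proof -
    let ?S = "T + scaleC_op z id_blinfun" and ?S' = "T' + scaleC_op (cnj z) id_blinfun"
    have "?S \<in> A"
      by (intro add_mem scale_mem T unit)
    moreover have "is_adjoint ?S ?S'"
      by (intro is_adjoint_add adj is_adjoint_scaleC adj_id)
    ultimately have "\<phi> (?S' o\<^sub>L ?S) \<in> \<real>\<^sub>\<ge>\<^sub>0"
      using \<phi> unfolding state_on_def by blast
    moreover have "?S' o\<^sub>L ?S = (T' o\<^sub>L T) + scaleC_op z T' + (scaleC_op (cnj z) T
        + scaleC_op (cnj z * z) id_blinfun)"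
      using clin by (intro blinfun_eqI)
        (simp add: blinfun.add_left blinfun.add_right scaleC_op_apply clinear_op_def
          Rep_ell2_inject[symmetric] plus_ell2.rep_eq scaleC_ell2.rep_eq fun_eq_iff algebra_simps)
    moreover have "\<phi> \<dots> = c + z * b' + (cnj z * b + cnj z * z * a)"
      by (simp add: add scale add_mem scale_mem T T' T'T unit a_def b_def b'_def c_def)
    ultimately show ?thesis
      by (simp add: algebra_simps)
  qed
  have "Im (z * cnj z * a + cnj z * b + z * b' + c) = 0" for z
    using pos[of z] by (auto simp: complex_nonneg_Reals_iff)
  \<comment> \<open>The imaginary parts at \<open>z = \<plusminus>1\<close> and \<open>z = \<plusminus>\<i>\<close> show that \<open>\<phi>\<close> is hermitian.\<close>
  from this[of 1] this[of "- 1"] this[of \<i>] this[of "- \<i>"] have b': "b' = cnj b"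
    by (intro complex_eqI) auto
  have "0 \<le> Re ((- b) * cnj (- b) * a + cnj (- b) * b + (- b) * b' + c)"
    using pos[of "- b"] by (simp add: complex_nonneg_Reals_iff)
  also have "\<dots> = (cmod b)\<^sup>2 * Re a - 2 * (cmod b)\<^sup>2 + Re c"
    by (subst a) (simp only: cmod_power2, simp add: b' power2_eq_square algebra_simps)
  finally have "(2 - Re a) * (cmod b)\<^sup>2 \<le> Re c"
    by (simp add: algebra_simps)
  also have "\<dots> \<le> cmod c"
    by (rule complex_Re_le_cmod)
  also have "\<dots> \<le> norm (T' o\<^sub>L T)"
    unfolding c_def by (rule state_on_bound[OF A \<phi> T'T])
  also have "\<dots> \<le> norm T' * norm T"
    by (rule norm_blinfun_compose)
  also have "\<dots> \<le> (norm T)\<^sup>2"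
    unfolding power2_eq_square by (intro mult_right_mono is_adjoint_norm_le[OF adj]) simp
  finally show ?thesis
    by (simp add: a_def b_def)
qed

text \<open>
  If \<open>a = \<phi>(1)\<close> were less than \<open>1\<close>, the preceding inequality would bound the norm of \<open>\<phi>\<close> by
  \<open>1 / sqrt (2 - a) < 1\<close>. The dense set \<open>D\<close> enters because the inequality needs an adjoint of \<open>T\<close>;
  for general \<open>T\<close> it follows by continuity.
\<close>

lemma state_on_unit:
  assumes A: "cstar_subalgebra A" and \<phi>: "state_on A \<phi>" and unit: "id_blinfun \<in> A"
    and D: "D \<subseteq> A" "A \<subseteq> closure D" "\<And>T. T \<in> D \<Longrightarrow> \<exists>T'. is_adjoint T T'"
  shows "\<phi> id_blinfun = 1"
proof -
  define a where "a = Re (\<phi> id_blinfun)"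
  have "id_blinfun o\<^sub>L id_blinfun = (id_blinfun :: 'a op)"
    by (rule blinfun_eqI) simp
  moreover have "is_adjoint id_blinfun id_blinfun"
    by (simp add: is_adjoint_def)
  ultimately have "\<phi> id_blinfun \<in> \<real>\<^sub>\<ge>\<^sub>0"
    using \<phi> unit unfolding state_on_def by metis
  then have a: "\<phi> id_blinfun = of_real a"
    unfolding a_def by (metis nonneg_Reals_cases Re_complex_of_real)
  have "a \<le> cmod (\<phi> id_blinfun)"
    by (simp add: a_def complex_Re_le_cmod)
  also have "\<dots> \<le> norm (id_blinfun :: 'a op)"
    by (rule state_on_bound[OF A \<phi> unit])
  also have "\<dots> \<le> 1"
    by (rule norm_blinfun_id_le)
  finally have "a \<le> 1" .
  have bound: "(2 - a) * (cmod (\<phi> T))\<^sup>2 \<le> (norm T)\<^sup>2" if T: "T \<in> A" for T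
  proof -
    obtain t where t: "\<And>n. t n \<in> D" "t \<longlonglongrightarrow> T"
      using subsetD[OF D(2) T] unfolding closure_sequential by blast
    have "(\<lambda>n. \<phi> (t n)) \<longlonglongrightarrow> \<phi> T"
      using state_on_continuous[OF A \<phi>] T t D(1)
      by (auto simp: continuous_on_sequentially comp_def)
    then have "(\<lambda>n. (2 - a) * (cmod (\<phi> (t n)))\<^sup>2) \<longlonglongrightarrow> (2 - a) * (cmod (\<phi> T))\<^sup>2"
      by (intro tendsto_intros)
    moreover have "(\<lambda>n. (norm (t n))\<^sup>2) \<longlonglongrightarrow> (norm T)\<^sup>2"
      by (intro tendsto_intros t)
    moreover have "(2 - a) * (cmod (\<phi> (t n)))\<^sup>2 \<le> (norm (t n))\<^sup>2" for n
      using state_on_cauchy_schwarz[OF A \<phi> unit] D t(1)[of n] unfolding a_def by blast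
    ultimately show ?thesis
      by (auto intro: LIMSEQ_le)
  qed
  have "functional_norm A \<phi> \<le> ennreal (sqrt (1 / (2 - a)))"
    unfolding functional_norm_def
  proof (rule SUP_least)
    fix T assume "T \<in> {T \<in> A. norm T \<le> 1}"
    then have T: "T \<in> A" "(norm T)\<^sup>2 \<le> 1"
      by (auto simp: power_le_one)
    with bound[of T] have "(2 - a) * (cmod (\<phi> T))\<^sup>2 \<le> 1"
      by simp
    with \<open>a \<le> 1\<close> have "(cmod (\<phi> T))\<^sup>2 \<le> 1 / (2 - a)"
      by (simp add: field_simps)
    then show "ennreal (cmod (\<phi> T)) \<le> ennreal (sqrt (1 / (2 - a)))"
      by (intro ennreal_leI real_le_rsqrt)
  qed
  then have "ennreal 1 \<le> ennreal (sqrt (1 / (2 - a)))"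
    using \<phi> by (simp add: state_on_def)
  then have "1 \<le> 1 / (2 - a)"
    using \<open>a \<le> 1\<close> by (subst (asm) ennreal_le_iff) auto
  with \<open>a \<le> 1\<close> have "a = 1"
    by (simp add: field_simps)
  with a show ?thesis
    by simp
qed


section \<open>The twisted group algebra\<close>

lemma lambda_op_compose:
  assumes "two_cocycle \<sigma>"
  shows "lambda_op \<sigma> g o\<^sub>L lambda_op \<sigma> h = scaleC_op (\<sigma> g h) (lambda_op \<sigma> (g + h))"
proof (rule op_eqI)
  fix \<xi> x
  define k where "k = - h + (- g + x)"
  have k: "h + k = - g + x" "- (g + h) + x = k"
    unfolding k_def by (simp_all only: minus_add add.assoc[symmetric] right_minus add_0_left)
  have "\<sigma> g h * \<sigma> (g + h) k = \<sigma> h k * \<sigma> g (h + k)"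
    using assms unfolding two_cocycle_def by blast
  then show "Rep_ell2 (blinfun_apply (lambda_op \<sigma> g o\<^sub>L lambda_op \<sigma> h) \<xi>) x
      = Rep_ell2 (blinfun_apply (scaleC_op (\<sigma> g h) (lambda_op \<sigma> (g + h))) \<xi>) x"
    by (simp add: Rep_scaleC_op lambda_op_apply[OF assms] k k_def[symmetric] mult_ac
        del: minus_add_distrib add_uminus_conv_diff)
qed

lemma lambda_op_zero:
  assumes "two_cocycle \<sigma>"
  shows "lambda_op \<sigma> 0 = id_blinfun"
  using assms by (intro op_eqI) (simp add: lambda_op_apply, simp add: two_cocycle_def)

lemma clinear_lambda_op:
  assumes "two_cocycle \<sigma>"
  shows "clinear_op (lambda_op \<sigma> g)"
  unfolding clinear_op_def
  by (intro allI Rep_ell2_inject[THEN iffD1] ext)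
    (simp add: lambda_op_apply[OF assms] scaleC_ell2.rep_eq)

lemma two_cocycle_inverse:
  assumes "two_cocycle \<sigma>"
  shows "\<sigma> g (- g) = \<sigma> (- g) g"
proof -
  have "\<sigma> g (- g) * \<sigma> (g + - g) g = \<sigma> (- g) g * \<sigma> g (- g + g)"
    using assms unfolding two_cocycle_def by blast
  with assms show ?thesis
    by (simp add: two_cocycle_def)
qed

text \<open>
  \<open>\<lambda>(g)\<close> is isometric, being a translation followed by a unimodular multiplier, and the right-hand
  side is its right inverse because \<open>\<lambda>(g) \<lambda>(-g) = \<sigma>(g, -g)\<close>.
\<close>

lemma lambda_op_adjoint:
  fixes \<sigma> :: "'g::group_add \<Rightarrow> 'g \<Rightarrow> complex"
  assumes \<sigma>: "two_cocycle \<sigma>"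
  shows "is_adjoint (lambda_op \<sigma> g) (scaleC_op (cnj (\<sigma> g (- g))) (lambda_op \<sigma> (- g)))"
proof -
  let ?T = "scaleC_op (cnj (\<sigma> g (- g))) (lambda_op \<sigma> (- g))"
  have unit: "\<sigma> a b * cnj (\<sigma> a b) = 1" for a b
    using \<sigma> by (simp add: complex_norm_square[symmetric] two_cocycle_def)
  have bij: "bij_betw (\<lambda>h. - g + h) UNIV UNIV"
    by (rule bij_betw_byWitness[where f' = "\<lambda>h. g + h"]) (auto simp: add.assoc[symmetric])
  have isom: "cinner_ell2 (blinfun_apply (lambda_op \<sigma> g) \<xi>) (blinfun_apply (lambda_op \<sigma> g) \<eta>)
      = cinner_ell2 \<xi> \<eta>" for \<xi> \<eta>
  proof -
    have "\<sigma> g h * x * (cnj (\<sigma> g h) * y) = x * y" for h x y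
    proof -
      have "\<sigma> g h * x * (cnj (\<sigma> g h) * y) = (\<sigma> g h * cnj (\<sigma> g h)) * (x * y)"
        by (simp only: mult_ac)
      then show ?thesis
        by (simp only: unit mult_1_left)
    qed
    then show ?thesis
      using infsum_reindex_bij_betw[OF bij, of "\<lambda>h. Rep_ell2 \<xi> h * cnj (Rep_ell2 \<eta> h)"]
      by (simp only: cinner_ell2.rep_eq lambda_op_apply[OF \<sigma>] complex_cnj_mult)
  qed
  have inv: "lambda_op \<sigma> g o\<^sub>L ?T = id_blinfun"
    using unit[of g "- g"]
    by (simp add: scaleC_op_compose_right clinear_lambda_op lambda_op_compose lambda_op_zero \<sigma>
        mult.commute)
  show ?thesis
    unfolding is_adjoint_def
  proof (intro allI)
    fix \<xi> \<eta>
    have "\<eta> = blinfun_apply (lambda_op \<sigma> g) (blinfun_apply ?T \<eta>)"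
      using arg_cong[OF inv, of "\<lambda>S. blinfun_apply S \<eta>"] by simp
    then show "cinner_ell2 (blinfun_apply (lambda_op \<sigma> g) \<xi>) \<eta> = cinner_ell2 \<xi> (blinfun_apply ?T \<eta>)"
      using isom by metis
  qed
qed

text \<open>
  Including all complex multiples among the generators makes the real \<^const>\<open>span\<close> a complex
  subspace.
\<close>

definition twisted_units :: "('g::group_add \<Rightarrow> 'g \<Rightarrow> complex) \<Rightarrow> 'g op set"
  where "twisted_units \<sigma> = {scaleC_op c (lambda_op \<sigma> g) | c g. True}"

definition twisted_algebra :: "('g::group_add \<Rightarrow> 'g \<Rightarrow> complex) \<Rightarrow> 'g op set"
  where "twisted_algebra \<sigma> = span (twisted_units \<sigma>)"

lemma twisted_algebra_induct [consumes 1, case_names subspace unit]: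
  assumes "T \<in> twisted_algebra \<sigma>" "subspace {T. P T}"
    "\<And>c g. P (scaleC_op c (lambda_op \<sigma> g))"
  shows "P T"
  using span_minimal[of "twisted_units \<sigma>" "{T. P T}"] assms
  by (auto simp: twisted_algebra_def twisted_units_def)

lemma twisted_algebra_unit: "scaleC_op c (lambda_op \<sigma> g) \<in> twisted_algebra \<sigma>"
  unfolding twisted_algebra_def twisted_units_def by (rule span_base) blast

lemma twisted_algebra_scaleC:
  assumes "T \<in> twisted_algebra \<sigma>"
  shows "scaleC_op c T \<in> twisted_algebra \<sigma>"
  using assms
proof (induction rule: twisted_algebra_induct)
  case subspace
  then show ?case
    by (rule subspaceI)
      (auto simp: scaleC_op_add scaleC_op_scaleR twisted_algebra_def
        intro: span_add span_scale span_zero)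
next
  case (unit d g)
  then show ?case
    by (simp add: twisted_algebra_unit)
qed

lemma twisted_algebra_compose:
  assumes \<sigma>: "two_cocycle \<sigma>" and S: "S \<in> twisted_algebra \<sigma>" and T: "T \<in> twisted_algebra \<sigma>"
  shows "S o\<^sub>L T \<in> twisted_algebra \<sigma>"
proof -
  note bil = bounded_bilinear_blinfun_compose
  have unit: "scaleC_op c (lambda_op \<sigma> g) o\<^sub>L T \<in> twisted_algebra \<sigma>" for c g
    using T
  proof (induction rule: twisted_algebra_induct)
    case subspace
    then show ?case
      by (rule subspaceI)
        (auto simp: bounded_bilinear.zero_right[OF bil] bounded_bilinear.add_right[OF bil]
          bounded_bilinear.scaleR_right[OF bil] twisted_algebra_def
          intro: span_add span_scale span_zero)
  next
    case (unit d h)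
    then show ?case
      by (simp add: scaleC_op_compose_left scaleC_op_compose_right clinear_lambda_op
          lambda_op_compose \<sigma> twisted_algebra_unit)
  qed
  show ?thesis
    using S
  proof (induction rule: twisted_algebra_induct)
    case subspace
    then show ?case
      by (rule subspaceI)
        (auto simp: bounded_bilinear.zero_left[OF bil] bounded_bilinear.add_left[OF bil]
          bounded_bilinear.scaleR_left[OF bil] twisted_algebra_def
          intro: span_add span_scale span_zero)
  qed (rule unit)
qed

lemma twisted_algebra_adjoint:
  assumes \<sigma>: "two_cocycle \<sigma>" and T: "T \<in> twisted_algebra \<sigma>"
  shows "\<exists>T'\<in>twisted_algebra \<sigma>. is_adjoint T T'"
  using T
proof (induction rule: twisted_algebra_induct)
  case subspace
  show ?case
  proof (rule subspaceI)
    show "0 \<in> {T. \<exists>T'\<in>twisted_algebra \<sigma>. is_adjoint T T'}"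
      using is_adjoint_zero by (auto simp: twisted_algebra_def intro!: bexI[of _ 0] span_zero)
    show "S + T \<in> {T. \<exists>T'\<in>twisted_algebra \<sigma>. is_adjoint T T'}"
      if "S \<in> {T. \<exists>T'\<in>twisted_algebra \<sigma>. is_adjoint T T'}"
        "T \<in> {T. \<exists>T'\<in>twisted_algebra \<sigma>. is_adjoint T T'}" for S T
      using that by (auto simp: twisted_algebra_def intro: is_adjoint_add span_add)
    show "r *\<^sub>R T \<in> {T. \<exists>T'\<in>twisted_algebra \<sigma>. is_adjoint T T'}"
      if T: "T \<in> {T. \<exists>T'\<in>twisted_algebra \<sigma>. is_adjoint T T'}" for r T
    proof -
      obtain T' where T': "T' \<in> twisted_algebra \<sigma>" "is_adjoint T T'"
        using T by blast
      then have "is_adjoint (r *\<^sub>R T) (r *\<^sub>R T')"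
        using is_adjoint_scaleC[OF T'(2), of "of_real r"]
        by (simp only: complex_cnj_complex_of_real scaleC_op_of_real)
      with T'(1) show ?thesis
        by (auto simp: twisted_algebra_def intro: span_scale)
    qed
  qed
next
  case (unit c g)
  show ?case
    using is_adjoint_scaleC[OF lambda_op_adjoint[OF \<sigma>]] twisted_algebra_unit
    by (metis scaleC_op_scaleC_op)
qed

lemma twisted_algebra_clinear:
  assumes \<sigma>: "two_cocycle \<sigma>"
  shows "twisted_algebra \<sigma> \<subseteq> {T. clinear_op T}"
proof
  fix T assume "T \<in> twisted_algebra \<sigma>"
  then show "T \<in> {T. clinear_op T}"
  proof (induction rule: twisted_algebra_induct)
    case subspace
    show ?case
      using subspace_clinear_op by simp
  next
    case (unit c g)
    show ?case
      using clinear_lambda_op[OF \<sigma>, of g]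
      by (auto simp: clinear_op_def scaleC_op_apply Rep_ell2_inject[symmetric]
          scaleC_ell2.rep_eq fun_eq_iff algebra_simps)
  qed
qed

lemma cstar_subalgebra_closure_twisted:
  assumes \<sigma>: "two_cocycle \<sigma>"
  shows "cstar_subalgebra (closure (twisted_algebra \<sigma>))"
  unfolding cstar_subalgebra_def
proof (intro conjI ballI allI impI)
  let ?D = "twisted_algebra \<sigma>"
  note bil = bounded_bilinear_blinfun_compose
  show "closed (closure ?D)"
    by simp
  show "0 \<in> closure ?D"
    using closure_subset[of ?D] by (auto simp: twisted_algebra_def intro: span_zero)
  fix S assume S: "S \<in> closure ?D"
  then obtain s where s: "\<And>n. s n \<in> ?D" "s \<longlonglongrightarrow> S"
    unfolding closure_sequential by blast
  show "clinear_op S"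
    using closure_minimal[OF twisted_algebra_clinear[OF \<sigma>] closed_clinear_op] S by blast
  show "scaleC_op c S \<in> closure ?D" for c
    unfolding closure_sequential
    by (rule exI[of _ "\<lambda>n. scaleC_op c (s n)"])
      (use s in \<open>auto simp: scaleC_op_def intro!: bounded_bilinear.tendsto[OF bil] tendsto_intros
         dest: twisted_algebra_scaleC\<close>, simp add: scaleC_op_def[symmetric] twisted_algebra_scaleC)
  show "S' \<in> closure ?D" if S': "is_adjoint S S'" for S'
  proof -
    obtain s' where s': "\<And>n. s' n \<in> ?D" "\<And>n. is_adjoint (s n) (s' n)"
      using twisted_algebra_adjoint[OF \<sigma> s(1)] by metis
    have "(\<lambda>n. norm (s n - S)) \<longlonglongrightarrow> 0"
      using s(2) by (simp add: tendsto_norm_zero LIM_zero)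
    moreover have "norm (s' n - S') \<le> norm (s n - S)" for n
      by (intro is_adjoint_norm_le is_adjoint_diff s' S')
    ultimately have "(\<lambda>n. s' n - S') \<longlonglongrightarrow> 0"
      by (intro Lim_null_comparison[of "\<lambda>n. s' n - S'" "\<lambda>n. norm (s n - S)"]) auto
    then have "s' \<longlonglongrightarrow> S'"
      by (rule LIM_zero_cancel)
    with s'(1) show ?thesis
      unfolding closure_sequential by blast
  qed
  fix T assume "T \<in> closure ?D"
  then obtain t where t: "\<And>n. t n \<in> ?D" "t \<longlonglongrightarrow> T"
    unfolding closure_sequential by blast
  show "S + T \<in> closure ?D"
    unfolding closure_sequential
    by (rule exI[of _ "\<lambda>n. s n + t n"])
      (use s t in \<open>auto simp: twisted_algebra_def intro!: tendsto_intros intro: span_add\<close>)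
  show "S o\<^sub>L T \<in> closure ?D"
    unfolding closure_sequential
    by (rule exI[of _ "\<lambda>n. s n o\<^sub>L t n"])
      (use s t in \<open>auto intro!: bounded_bilinear.tendsto[OF bil] twisted_algebra_compose \<sigma>\<close>)
qed

text \<open>
  The closure already is a C*-algebra, hence the smallest one containing the \<open>\<lambda>(g)\<close>. This description
  reduces identities between continuous linear maps to these unitaries.
\<close>

lemma reduced_twisted_cstar_eq:
  assumes \<sigma>: "two_cocycle \<sigma>"
  shows "reduced_twisted_cstar \<sigma> = closure (twisted_algebra \<sigma>)"
proof
  have "lambda_op \<sigma> g \<in> closure (twisted_algebra \<sigma>)" for g
    using twisted_algebra_unit[of 1 \<sigma> g] closure_subset by auto
  then show "reduced_twisted_cstar \<sigma> \<subseteq> closure (twisted_algebra \<sigma>)"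
    unfolding reduced_twisted_cstar_def cstar_generated_def
    using cstar_subalgebra_closure_twisted[OF \<sigma>] by blast
  show "closure (twisted_algebra \<sigma>) \<subseteq> reduced_twisted_cstar \<sigma>"
    unfolding reduced_twisted_cstar_def cstar_generated_def
  proof (rule Inter_greatest)
    fix A assume "A \<in> {A. cstar_subalgebra A \<and> range (lambda_op \<sigma>) \<subseteq> A}"
    then have A: "cstar_subalgebra A" "\<And>g. lambda_op \<sigma> g \<in> A"
      by auto
    then have "twisted_units \<sigma> \<subseteq> A"
      by (auto simp: twisted_units_def cstar_subalgebra_def)
    then have "twisted_algebra \<sigma> \<subseteq> A"
      unfolding twisted_algebra_def by (intro span_minimal cstar_subalgebra_subspace A(1))
    then show "closure (twisted_algebra \<sigma>) \<subseteq> A"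
      using A(1) by (intro closure_minimal) (auto simp: cstar_subalgebra_def)
  qed
qed


section \<open>The canonical trace\<close>

lift_definition point_mass :: "'a \<Rightarrow> 'a ell2" is "\<lambda>a x. if x = a then 1 else 0"
  by (rule finite_nonzero_values_imp_summable_on) simp

lemma cinner_point_mass: "cinner_ell2 \<xi> (point_mass a) = Rep_ell2 \<xi> a"
proof -
  have "cinner_ell2 \<xi> (point_mass a) = (\<Sum>\<^sub>\<infinity>x\<in>{a}. Rep_ell2 \<xi> x)"
    unfolding cinner_ell2.rep_eq by (rule infsum_cong_neutral) (auto simp: point_mass.rep_eq)
  then show ?thesis
    by simp
qed

lemma norm_point_mass [simp]: "norm (point_mass a) = 1"
  using cinner_ell2_self[of "point_mass a"]
  by (simp add: cinner_point_mass point_mass.rep_eq del: of_real_power)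
    (metis norm_ge_zero real_sqrt_unique real_sqrt_one)

lemma cmod_Rep_ell2_le: "cmod (Rep_ell2 \<xi> a) \<le> norm \<xi>"
proof -
  have "(\<Sum>\<^sub>\<infinity>x\<in>{a}. (cmod (Rep_ell2 \<xi> x))\<^sup>2) \<le> (\<Sum>\<^sub>\<infinity>x. (cmod (Rep_ell2 \<xi> x))\<^sup>2)"
    using Rep_ell2[of \<xi>] by (intro infsum_mono_neutral) auto
  then show ?thesis
    by (simp add: norm_ell2.rep_eq real_le_rsqrt)
qed

definition vacuum_coeff :: "'g::group_add op \<Rightarrow> complex"
  where "vacuum_coeff T = Rep_ell2 (blinfun_apply T (point_mass 0)) 0"

lemma vacuum_coeff_add: "vacuum_coeff (S + T) = vacuum_coeff S + vacuum_coeff T"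
  by (simp add: vacuum_coeff_def blinfun.add_left plus_ell2.rep_eq)

lemma vacuum_coeff_scaleC: "vacuum_coeff (scaleC_op c T) = c * vacuum_coeff T"
  by (simp add: vacuum_coeff_def Rep_scaleC_op)

lemma vacuum_coeff_scaleR: "vacuum_coeff (r *\<^sub>R T) = of_real r * vacuum_coeff T"
  by (simp flip: scaleC_op_of_real add: vacuum_coeff_scaleC)

lemma vacuum_coeff_bound: "cmod (vacuum_coeff T) \<le> norm T"
  using order_trans[OF cmod_Rep_ell2_le norm_blinfun[of T "point_mass 0"]]
  by (simp add: vacuum_coeff_def)

lemma vacuum_coeff_tendsto:
  fixes T :: "'g::group_add op"
  assumes "(t \<longlongrightarrow> T) F"
  shows "((\<lambda>n. vacuum_coeff (t n)) \<longlongrightarrow> vacuum_coeff T) F"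
proof -
  have "bounded_linear (vacuum_coeff :: 'g op \<Rightarrow> complex)"
    by (rule bounded_linear_intro[where K = 1])
      (simp_all add: vacuum_coeff_add vacuum_coeff_scaleR scaleR_conv_of_real vacuum_coeff_bound)
  from bounded_linear.tendsto[OF this assms] show ?thesis .
qed

lemma vacuum_coeff_lambda_op:
  assumes "two_cocycle \<sigma>"
  shows "vacuum_coeff (lambda_op \<sigma> g) = (if g = 0 then 1 else 0)"
  using assms by (simp add: vacuum_coeff_def lambda_op_apply point_mass.rep_eq)
    (simp add: two_cocycle_def)

text \<open>
  On generators, \<open>\<lambda>(g) \<lambda>(h)\<close> has vacuum coefficient \<open>\<sigma>(g, -g)\<close> if \<open>h = -g\<close> and \<open>0\<close> otherwise, which
  is symmetric because \<open>\<sigma>(g, -g) = \<sigma>(-g, g)\<close>.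
\<close>

lemma vacuum_coeff_tracial:
  assumes \<sigma>: "two_cocycle \<sigma>" and S: "S \<in> twisted_algebra \<sigma>" and T: "T \<in> twisted_algebra \<sigma>"
  shows "vacuum_coeff (S o\<^sub>L T) = vacuum_coeff (T o\<^sub>L S)"
proof -
  note bil = bounded_bilinear_blinfun_compose
  note bil_simps = bounded_bilinear.zero_left[OF bil] bounded_bilinear.zero_right[OF bil]
    bounded_bilinear.add_left[OF bil] bounded_bilinear.add_right[OF bil]
    bounded_bilinear.scaleR_left[OF bil] bounded_bilinear.scaleR_right[OF bil]
  have unit: "vacuum_coeff (scaleC_op c (lambda_op \<sigma> g) o\<^sub>L T)
      = vacuum_coeff (T o\<^sub>L scaleC_op c (lambda_op \<sigma> g))" for c g
    using T
  proof (induction rule: twisted_algebra_induct)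
    case subspace
    show ?case
      by (rule subspaceI) (simp_all add: bil_simps vacuum_coeff_add vacuum_coeff_scaleR)
  next
    case (unit d h)
    have "g + h = 0 \<longleftrightarrow> h = - g" "h + g = 0 \<longleftrightarrow> h = - g"
      by (metis add_eq_0_iff neg_equal_iff_equal minus_minus)+
    then show ?case
      by (auto simp: scaleC_op_compose_left scaleC_op_compose_right clinear_lambda_op
          lambda_op_compose vacuum_coeff_scaleC vacuum_coeff_lambda_op \<sigma> two_cocycle_inverse)
  qed
  show ?thesis
    using S
  proof (induction rule: twisted_algebra_induct)
    case subspace
    show ?case
      by (rule subspaceI) (simp_all add: bil_simps vacuum_coeff_add vacuum_coeff_scaleR)
  qed (rule unit)
qed

lemma canonical_trace:
  assumes \<sigma>: "two_cocycle \<sigma>"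
  shows "tracial_state_on (reduced_twisted_cstar \<sigma>)
    (restrict vacuum_coeff (reduced_twisted_cstar \<sigma>))"
proof -
  note bil = bounded_bilinear_blinfun_compose
  define A where "A = closure (twisted_algebra \<sigma>)"
  have A: "cstar_subalgebra A"
    unfolding A_def by (rule cstar_subalgebra_closure_twisted[OF \<sigma>])
  have unit: "id_blinfun \<in> A"
    using twisted_algebra_unit[of 1 \<sigma> 0] closure_subset by (auto simp: A_def lambda_op_zero[OF \<sigma>])
  have comp: "S o\<^sub>L T \<in> A" if "S \<in> A" "T \<in> A" for S T
    using A that by (simp add: cstar_subalgebra_def)
  have trace: "vacuum_coeff (S o\<^sub>L T) = vacuum_coeff (T o\<^sub>L S)" if "S \<in> A" "T \<in> A" for S T
  proof -
    obtain s where s: "\<And>n. s n \<in> twisted_algebra \<sigma>" "s \<longlonglongrightarrow> S"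
      using \<open>S \<in> A\<close> unfolding A_def closure_sequential by blast
    obtain t where t: "\<And>n. t n \<in> twisted_algebra \<sigma>" "t \<longlonglongrightarrow> T"
      using \<open>T \<in> A\<close> unfolding A_def closure_sequential by blast
    have "(\<lambda>n. vacuum_coeff (s n o\<^sub>L t n)) \<longlonglongrightarrow> vacuum_coeff (S o\<^sub>L T)"
      by (intro vacuum_coeff_tendsto bounded_bilinear.tendsto[OF bil] s t)
    moreover have "(\<lambda>n. vacuum_coeff (s n o\<^sub>L t n)) \<longlonglongrightarrow> vacuum_coeff (T o\<^sub>L S)"
      unfolding vacuum_coeff_tracial[OF \<sigma> s(1) t(1)]
      by (intro vacuum_coeff_tendsto bounded_bilinear.tendsto[OF bil] s t)
    ultimately show ?thesis
      by (rule LIMSEQ_unique)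
  qed
  have pos: "vacuum_coeff (S' o\<^sub>L S) \<in> \<real>\<^sub>\<ge>\<^sub>0" if "is_adjoint S S'" for S S'
  proof -
    let ?u = "blinfun_apply S (point_mass 0)"
    have "vacuum_coeff (S' o\<^sub>L S) = cinner_ell2 (blinfun_apply S' ?u) (point_mass 0)"
      by (simp add: vacuum_coeff_def cinner_point_mass)
    also have "\<dots> = cinner_ell2 ?u ?u"
      using is_adjoint_sym[OF that] by (simp add: is_adjoint_def)
    finally show ?thesis
      by (simp add: cinner_ell2_self del: of_real_power)
  qed
  have norm: "functional_norm A (restrict vacuum_coeff A) = 1"
  proof (rule antisym)
    show "functional_norm A (restrict vacuum_coeff A) \<le> 1"
      unfolding functional_norm_def
    proof (rule SUP_least)
      fix T assume "T \<in> {T \<in> A. norm T \<le> 1}"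
      then show "ennreal (cmod (restrict vacuum_coeff A T)) \<le> 1"
        using order_trans[OF vacuum_coeff_bound[of T], of 1] by (simp add: ennreal_le_1)
    qed
    have "ennreal (cmod (restrict vacuum_coeff A id_blinfun))
        \<le> functional_norm A (restrict vacuum_coeff A)"
      unfolding functional_norm_def by (intro SUP_upper) (simp add: unit norm_blinfun_id_le)
    then show "1 \<le> functional_norm A (restrict vacuum_coeff A)"
      using vacuum_coeff_lambda_op[OF \<sigma>, of 0] by (simp add: unit lambda_op_zero[OF \<sigma>])
  qed
  have lin: "linear_functional_on A (restrict vacuum_coeff A)"
    using A by (simp add: linear_functional_on_def cstar_subalgebra_def vacuum_coeff_add
        vacuum_coeff_scaleC)
  have adj: "S' \<in> A" if "S \<in> A" "is_adjoint S S'" for S S'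
    using A that unfolding cstar_subalgebra_def by blast
  have "state_on A (restrict vacuum_coeff A)"
    using norm lin by (simp add: state_on_def comp adj pos)
  then have "tracial_state_on A (restrict vacuum_coeff A)"
    by (simp add: tracial_state_on_def comp trace)
  then show ?thesis
    by (simp add: A_def reduced_twisted_cstar_eq[OF \<sigma>])
qed


section \<open>Values of tracial states on the canonical unitaries\<close>

lemma lambda_op_in_cstar:
  assumes "two_cocycle \<sigma>"
  shows "lambda_op \<sigma> g \<in> reduced_twisted_cstar \<sigma>"
  unfolding reduced_twisted_cstar_def cstar_generated_def by blast

lemma cstar_subalgebra_reduced:
  assumes "two_cocycle \<sigma>"
  shows "cstar_subalgebra (reduced_twisted_cstar \<sigma>)"
  unfolding reduced_twisted_cstar_eq[OF assms] by (rule cstar_subalgebra_closure_twisted[OF assms])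

text \<open>
  For commuting \<open>g\<close> and \<open>h\<close> the unitaries satisfy \<open>\<sigma>(g, h) \<lambda>(h) \<lambda>(g) = \<sigma>(h, g) \<lambda>(g) \<lambda>(h)\<close>. After
  right multiplication by \<open>\<lambda>(-h)\<close>, a scalar multiple of \<open>\<lambda>(h)\<^sup>*\<close>, both products have the same trace.
\<close>

lemma trace_nonregular:
  assumes \<sigma>: "two_cocycle \<sigma>" and \<tau>: "tracial_state_on (reduced_twisted_cstar \<sigma>) \<tau>"
    and "\<not> regular_element \<sigma> g"
  shows "\<tau> (lambda_op \<sigma> g) = 0"
proof -
  obtain h where h: "g + h = h + g" "\<sigma> g h \<noteq> \<sigma> h g"
    using assms(3) by (auto simp: regular_element_def)
  let ?A = "reduced_twisted_cstar \<sigma>" and ?u = "lambda_op \<sigma>"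
  note [simp] = lambda_op_in_cstar[OF \<sigma>]
  have right_id: "\<sigma> a 0 = 1" for a
    using \<sigma> by (simp add: two_cocycle_def)
  have comp [simp]: "S o\<^sub>L T \<in> ?A" if "S \<in> ?A" "T \<in> ?A" for S T
    using cstar_subalgebra_reduced[OF \<sigma>] that by (simp add: cstar_subalgebra_def)
  have scale [simp]: "\<tau> (scaleC_op c S) = c * \<tau> S" if "S \<in> ?A" for c S
    using \<tau> that by (simp add: tracial_state_on_def state_on_def linear_functional_on_def)
  have cyc: "\<tau> (S o\<^sub>L T) = \<tau> (T o\<^sub>L S)" if "S \<in> ?A" "T \<in> ?A" for S T
    using \<tau> that by (simp add: tracial_state_on_def)
  have 1: "\<tau> ((?u g o\<^sub>L ?u h) o\<^sub>L ?u (- h)) = \<sigma> h (- h) * \<tau> (?u g)"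
    unfolding blinfun_compose_assoc by (simp add: lambda_op_compose right_id scaleC_op_compose_right
        clinear_lambda_op \<sigma>)
  have "\<tau> ((?u h o\<^sub>L ?u g) o\<^sub>L ?u (- h)) = \<tau> ((?u g o\<^sub>L ?u (- h)) o\<^sub>L ?u h)"
    by (simp add: blinfun_compose_assoc cyc[of "?u h"])
  also have "\<dots> = \<sigma> h (- h) * \<tau> (?u g)"
    unfolding blinfun_compose_assoc by (simp add: lambda_op_compose right_id scaleC_op_compose_right
        clinear_lambda_op \<sigma> two_cocycle_inverse)
  finally have 2: "\<tau> ((?u h o\<^sub>L ?u g) o\<^sub>L ?u (- h)) = \<sigma> h (- h) * \<tau> (?u g)" .
  have "scaleC_op (\<sigma> g h) (?u h o\<^sub>L ?u g) = scaleC_op (\<sigma> h g) (?u g o\<^sub>L ?u h)"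
    by (simp add: lambda_op_compose \<sigma> h(1) mult.commute)
  then have "\<tau> (scaleC_op (\<sigma> g h) (?u h o\<^sub>L ?u g) o\<^sub>L ?u (- h))
      = \<tau> (scaleC_op (\<sigma> h g) (?u g o\<^sub>L ?u h) o\<^sub>L ?u (- h))"
    by simp
  then have "\<sigma> g h * (\<sigma> h (- h) * \<tau> (?u g)) = \<sigma> h g * (\<sigma> h (- h) * \<tau> (?u g))"
    by (simp add: scaleC_op_compose_left 1 2)
  moreover have "cmod (\<sigma> h (- h)) = 1"
    using \<sigma> by (simp add: two_cocycle_def)
  then have "\<sigma> h (- h) \<noteq> 0"
    by auto
  ultimately show ?thesis
    using h(2) by auto
qed

text \<open>
  Both \<open>\<lambda>(h) (\<lambda>(g) \<lambda>(-h))\<close> and \<open>(\<lambda>(g) \<lambda>(-h)) \<lambda>(h)\<close> have the same trace; the first is a unimodular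
  multiple of \<open>\<lambda>(h + g - h)\<close>, the second of \<open>\<lambda>(g)\<close>.
\<close>

lemma trace_conj_class:
  assumes \<sigma>: "two_cocycle \<sigma>" and \<tau>: "tracial_state_on (reduced_twisted_cstar \<sigma>) \<tau>"
    and "x \<in> conj_class g"
  shows "\<exists>c. cmod c = 1 \<and> c * \<tau> (lambda_op \<sigma> x) = \<tau> (lambda_op \<sigma> g)"
proof -
  obtain h where x: "x = h + g - h"
    using assms(3) by (auto simp: conj_class_def)
  let ?A = "reduced_twisted_cstar \<sigma>" and ?u = "lambda_op \<sigma>"
  note [simp] = lambda_op_in_cstar[OF \<sigma>]
  have right_id: "\<sigma> a 0 = 1" for a
    using \<sigma> by (simp add: two_cocycle_def)
  have comp [simp]: "S o\<^sub>L T \<in> ?A" if "S \<in> ?A" "T \<in> ?A" for S T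
    using cstar_subalgebra_reduced[OF \<sigma>] that by (simp add: cstar_subalgebra_def)
  have scale [simp]: "\<tau> (scaleC_op c S) = c * \<tau> S" if "S \<in> ?A" for c S
    using \<tau> that by (simp add: tracial_state_on_def state_on_def linear_functional_on_def)
  have unit: "cmod (\<sigma> a b) = 1" for a b
    using \<sigma> by (simp add: two_cocycle_def)
  have "\<tau> (?u h o\<^sub>L (?u g o\<^sub>L ?u (- h))) = \<tau> ((?u g o\<^sub>L ?u (- h)) o\<^sub>L ?u h)"
    using \<tau> by (simp add: tracial_state_on_def)
  also have "\<dots> = \<sigma> (- h) h * \<tau> (?u g)"
    unfolding blinfun_compose_assoc by (simp add: lambda_op_compose right_id scaleC_op_compose_right
        clinear_lambda_op \<sigma>)
  also have "\<tau> (?u h o\<^sub>L (?u g o\<^sub>L ?u (- h))) = \<sigma> g (- h) * \<sigma> h (g - h) * \<tau> (?u x)"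
    by (simp add: lambda_op_compose scaleC_op_compose_right clinear_lambda_op \<sigma> x add_diff_eq)
  finally have eq: "\<sigma> g (- h) * \<sigma> h (g - h) * \<tau> (?u x) = \<sigma> (- h) h * \<tau> (?u g)" .
  have "\<sigma> (- h) h \<noteq> 0"
    using unit[of "- h" h] by auto
  with eq show ?thesis
    by (intro exI[of _ "\<sigma> g (- h) * \<sigma> h (g - h) / \<sigma> (- h) h"])
      (simp add: norm_mult norm_divide unit)
qed

text \<open>
  For unimodular coefficients the weighted norm is at most \<open>k \<bar>F\<bar>\<^sup>1\<^sup>/\<^sup>2\<close>; this square root beats the
  factor \<open>\<bar>F\<bar>\<close> that a trace picks up from a conjugacy class.
\<close>

lemma norm_annulus_sum_le:
  assumes \<kappa>: "\<And>g. 1 \<le> \<kappa> g" and M: "0 < M"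
    and decay: "\<And>f. finite {g. f g \<noteq> 0} \<Longrightarrow>
      ennreal (norm (\<Sum>g\<in>{g. f g \<noteq> 0}. scaleC_op (f g) (lambda_op \<sigma> g)))
        \<le> ennreal M * weighted_norm \<kappa> f"
    and F: "finite F" "\<And>x. x \<in> F \<Longrightarrow> \<kappa> x \<le> k" and c: "\<And>x. x \<in> F \<Longrightarrow> cmod (c x) = 1"
  shows "(norm (\<Sum>x\<in>F. scaleC_op (c x) (lambda_op \<sigma> x)))\<^sup>2 \<le> M\<^sup>2 * (k\<^sup>2 * real (card F))"
proof -
  define f where "f x = (if x \<in> F then c x else 0)" for x
  have supp: "{x. f x \<noteq> 0} = F"
    using c by (force simp: f_def)
  let ?w = "\<lambda>x. (cmod (f x * of_real (\<kappa> x)))\<^sup>2"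
  have summable: "?w summable_on UNIV"
    by (rule finite_nonzero_values_imp_summable_on, rule finite_subset[OF _ F(1)])
      (auto simp: f_def)
  have "(\<Sum>\<^sub>\<infinity>x. ?w x) = (\<Sum>\<^sub>\<infinity>x\<in>F. ?w x)"
    by (rule infsum_cong_neutral) (auto simp: f_def)
  also have "\<dots> = (\<Sum>x\<in>F. (\<kappa> x)\<^sup>2)"
    using F by (auto simp: f_def norm_mult c intro!: sum.cong)
  also have "\<dots> \<le> (\<Sum>x\<in>F. k\<^sup>2)"
    using F(2) \<kappa> by (intro sum_mono power_mono) (auto intro: order_trans[OF zero_le_one])
  finally have w: "(\<Sum>\<^sub>\<infinity>x. ?w x) \<le> k\<^sup>2 * real (card F)"
    by (simp add: mult.commute)
  have "ennreal (norm (\<Sum>x\<in>F. scaleC_op (f x) (lambda_op \<sigma> x)))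
      \<le> ennreal M * ennreal (sqrt (\<Sum>\<^sub>\<infinity>x. ?w x))"
    using decay[of f] F(1) summable by (simp add: supp weighted_norm_def)
  also have "\<dots> = ennreal (M * sqrt (\<Sum>\<^sub>\<infinity>x. ?w x))"
    using M by (intro ennreal_mult[symmetric]) (auto intro: infsum_nonneg)
  finally have "norm (\<Sum>x\<in>F. scaleC_op (f x) (lambda_op \<sigma> x)) \<le> M * sqrt (\<Sum>\<^sub>\<infinity>x. ?w x)"
    using M by (subst (asm) ennreal_le_iff) (auto intro!: mult_nonneg_nonneg infsum_nonneg)
  also have "(\<Sum>x\<in>F. scaleC_op (f x) (lambda_op \<sigma> x)) = (\<Sum>x\<in>F. scaleC_op (c x) (lambda_op \<sigma> x))"
    by (simp add: f_def)
  finally have "(norm (\<Sum>x\<in>F. scaleC_op (c x) (lambda_op \<sigma> x)))\<^sup>2 \<le> (M * sqrt (\<Sum>\<^sub>\<infinity>x. ?w x))\<^sup>2"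
    by (intro power_mono) auto
  also have "\<dots> = M\<^sup>2 * (\<Sum>\<^sub>\<infinity>x. ?w x)"
    by (simp add: power_mult_distrib infsum_nonneg)
  also have "\<dots> \<le> M\<^sup>2 * (k\<^sup>2 * real (card F))"
    by (intro mult_left_mono w) simp
  finally show ?thesis .
qed

lemma trace_regular:
  assumes \<sigma>: "two_cocycle \<sigma>" and \<tau>: "tracial_state_on (reduced_twisted_cstar \<sigma>) \<tau>"
    and \<kappa>: "\<And>g. 1 \<le> \<kappa> g" and proper: "proper_weight \<kappa>" and decay: "decaying \<sigma> \<kappa>"
    and growth: "superpolynomial_growth \<kappa> (conj_class g)"
  shows "\<tau> (lambda_op \<sigma> g) = 0"
proof (rule ccontr)
  assume "\<tau> (lambda_op \<sigma> g) \<noteq> 0"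
  define t where "t = cmod (\<tau> (lambda_op \<sigma> g))"
  have t: "t > 0"
    using \<open>\<tau> (lambda_op \<sigma> g) \<noteq> 0\<close> by (simp add: t_def)
  obtain M where M: "M > 0" "\<And>f. finite {g. f g \<noteq> 0} \<Longrightarrow>
      ennreal (norm (\<Sum>g\<in>{g. f g \<noteq> 0}. scaleC_op (f g) (lambda_op \<sigma> g)))
        \<le> ennreal M * weighted_norm \<kappa> f"
    using decay unfolding decaying_def by blast
  obtain K where K: "infinite K" "\<And>k. k \<in> K \<Longrightarrow>
      real (card (conj_class g \<inter> {g. real k - 1 < \<kappa> g \<and> \<kappa> g \<le> real k}))
        > poly (monom (M\<^sup>2 / t\<^sup>2) 2) (real k)"
    using growth unfolding superpolynomial_growth_def by blast
  then obtain k where k: "k \<in> K"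
    by (metis finite.emptyI ex_in_conv)
  define F where "F = conj_class g \<inter> {g. real k - 1 < \<kappa> g \<and> \<kappa> g \<le> real k}"
  have "F \<subseteq> \<kappa> -` {real k - 1 .. real k}"
    by (auto simp: F_def)
  moreover have "finite (\<kappa> -` {real k - 1 .. real k})"
    using proper by (simp add: proper_weight_def)
  ultimately have F: "finite F"
    by (rule finite_subset)
  have large: "M\<^sup>2 / t\<^sup>2 * (real k)\<^sup>2 < real (card F)"
    using K(2)[OF k] by (simp add: F_def poly_monom)
  have "\<forall>x\<in>F. \<exists>c. cmod c = 1 \<and> c * \<tau> (lambda_op \<sigma> x) = \<tau> (lambda_op \<sigma> g)"
    using trace_conj_class[OF \<sigma> \<tau>] by (simp add: F_def)
  then obtain c where c: "\<And>x. x \<in> F \<Longrightarrow> cmod (c x) = 1"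
    "\<And>x. x \<in> F \<Longrightarrow> c x * \<tau> (lambda_op \<sigma> x) = \<tau> (lambda_op \<sigma> g)"
    by metis
  define S where "S = (\<Sum>x\<in>F. scaleC_op (c x) (lambda_op \<sigma> x))"
  note A = cstar_subalgebra_reduced[OF \<sigma>]
  have \<phi>: "state_on (reduced_twisted_cstar \<sigma>) \<tau>"
    using \<tau> by (simp add: tracial_state_on_def)
  have "S \<in> reduced_twisted_cstar \<sigma>"
    unfolding S_def using A lambda_op_in_cstar[OF \<sigma>]
    by (intro subspace_sum cstar_subalgebra_subspace) (auto simp: cstar_subalgebra_def)
  then have "cmod (\<tau> S) \<le> norm S"
    by (rule state_on_bound[OF A \<phi>])
  moreover have "\<tau> S = (\<Sum>x\<in>F. c x * \<tau> (lambda_op \<sigma> x))"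
    unfolding S_def using \<phi> F lambda_op_in_cstar[OF \<sigma>]
    by (intro linear_functional_on_sum[OF A]) (auto simp: state_on_def)
  then have "\<tau> S = of_nat (card F) * \<tau> (lambda_op \<sigma> g)"
    by (simp add: c(2))
  ultimately have "real (card F) * t \<le> norm S"
    by (simp add: norm_mult t_def)
  then have "(real (card F) * t)\<^sup>2 \<le> (norm S)\<^sup>2"
    using t by (intro power_mono) auto
  also have "\<dots> \<le> M\<^sup>2 * ((real k)\<^sup>2 * real (card F))"
    unfolding S_def by (rule norm_annulus_sum_le[OF \<kappa> M F]) (auto simp: F_def c(1)[unfolded F_def])
  finally have "real (card F) * (real (card F) * t\<^sup>2) \<le> real (card F) * (M\<^sup>2 * (real k)\<^sup>2)"
    by (simp add: power2_eq_square mult_ac)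
  moreover have "0 < real (card F)"
    using large by (rule le_less_trans[rotated]) simp
  ultimately have "real (card F) * t\<^sup>2 \<le> M\<^sup>2 * (real k)\<^sup>2"
    by simp
  with large t show False
    by (simp add: field_simps)
qed

lemma tracial_state_eqI:
  assumes \<sigma>: "two_cocycle \<sigma>"
    and \<tau>: "tracial_state_on (reduced_twisted_cstar \<sigma>) \<tau>"
    and \<rho>: "tracial_state_on (reduced_twisted_cstar \<sigma>) \<rho>"
    and eq: "\<And>g. g \<noteq> 0 \<Longrightarrow> \<tau> (lambda_op \<sigma> g) = \<rho> (lambda_op \<sigma> g)"
  shows "\<tau> = \<rho>"
proof -
  define A D where "A = reduced_twisted_cstar \<sigma>" and "D = twisted_algebra \<sigma>"
  have A: "cstar_subalgebra A"
    unfolding A_def by (rule cstar_subalgebra_reduced[OF \<sigma>])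
  have AD: "A = closure D"
    unfolding A_def D_def by (rule reduced_twisted_cstar_eq[OF \<sigma>])
  have D: "D \<subseteq> A"
    by (simp add: AD closure_subset)
  have \<lambda>: "lambda_op \<sigma> g \<in> A" for g
    by (simp add: A_def lambda_op_in_cstar \<sigma>)
  have unit: "\<phi> (lambda_op \<sigma> 0) = 1" if "state_on A \<phi>" for \<phi>
    unfolding lambda_op_zero[OF \<sigma>] using twisted_algebra_adjoint[OF \<sigma>] \<lambda>[of 0] AD D
    by (intro state_on_unit[OF A that, of D]) (auto simp: D_def lambda_op_zero[OF \<sigma>])
  have st: "state_on A \<tau>" "state_on A \<rho>" and ext: "\<tau> \<in> extensional A" "\<rho> \<in> extensional A"
    using \<tau> \<rho> by (simp_all add: A_def tracial_state_on_def)
  have gen: "\<tau> (lambda_op \<sigma> g) = \<rho> (lambda_op \<sigma> g)" for g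
    using eq[of g] unit[OF st(1)] unit[OF st(2)] by (cases "g = 0") auto
  have lin: "linear_functional_on A \<tau>" "linear_functional_on A \<rho>"
    using st by (simp_all add: state_on_def)
  have scale: "\<tau> (scaleC_op c T) = c * \<tau> T" "\<rho> (scaleC_op c T) = c * \<rho> T" if "T \<in> A" for c T
    using lin that by (simp_all add: linear_functional_on_def)
  have onD: "T \<in> A \<and> \<tau> T = \<rho> T" if "T \<in> D" for T
    using that unfolding D_def
  proof (induction rule: twisted_algebra_induct)
    case subspace
    have "\<tau> 0 = \<rho> 0" "0 \<in> A"
      using scale[of 0 0] A by (auto simp: cstar_subalgebra_def)
    moreover have "\<tau> (r *\<^sub>R T) = \<rho> (r *\<^sub>R T)" if "T \<in> A" "\<tau> T = \<rho> T" for r T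
      using scale[OF that(1), of "of_real r"] that(2) by (simp add: scaleC_op_of_real)
    ultimately show ?case
      using lin cstar_subalgebra_subspace[OF A]
      by (intro subspaceI) (auto simp: linear_functional_on_def subspace_def)
  next
    case (unit c g)
    show ?case
      using A \<lambda>[of g] gen[of g] scale[OF \<lambda>[of g]] by (simp add: cstar_subalgebra_def)
  qed
  have "\<tau> T = \<rho> T" if T: "T \<in> A" for T
  proof -
    obtain s where s: "\<And>n. s n \<in> D" "s \<longlonglongrightarrow> T"
      using T unfolding AD closure_sequential by blast
    have "s n \<in> A" for n
      using s(1) D by blast
    then have "(\<lambda>n. \<tau> (s n)) \<longlonglongrightarrow> \<tau> T" "(\<lambda>n. \<rho> (s n)) \<longlonglongrightarrow> \<rho> T"
      using state_on_continuous[OF A st(1)] state_on_continuous[OF A st(2)] T s(2)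
      by (simp_all add: continuous_on_sequentially comp_def)
    then show ?thesis
      using onD[OF s(1)] by (auto intro: LIMSEQ_unique)
  qed
  with ext show ?thesis
    by (rule extensionalityI)
qed

theorem theoremC1:
  fixes \<sigma> :: "'g::group_add \<Rightarrow> 'g \<Rightarrow> complex" and \<kappa> :: "'g \<Rightarrow> real"
  assumes "two_cocycle \<sigma>"
    and "\<And>g. 1 \<le> \<kappa> g"
    and "proper_weight \<kappa>"
    and "decaying \<sigma> \<kappa>"
    and "\<And>C. regular_conj_class \<sigma> C \<Longrightarrow> C \<noteq> {0} \<Longrightarrow> superpolynomial_growth \<kappa> C"
  shows "unique_trace_property \<sigma>"
proof -
  have zero: "\<tau> (lambda_op \<sigma> g) = 0"
    if \<tau>: "tracial_state_on (reduced_twisted_cstar \<sigma>) \<tau>" and "g \<noteq> 0" for \<tau> g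
  proof (cases "regular_element \<sigma> g")
    case True
    have "g \<in> conj_class g"
      unfolding conj_class_def by (rule range_eqI[of _ _ 0]) simp
    with \<open>g \<noteq> 0\<close> have "conj_class g \<noteq> {0}"
      by auto
    with True have "superpolynomial_growth \<kappa> (conj_class g)"
      by (intro assms(5)) (auto simp: regular_conj_class_def)
    then show ?thesis
      using trace_regular[OF assms(1) \<tau> assms(2-4)] by blast
  next
    case False
    then show ?thesis
      by (rule trace_nonregular[OF assms(1) \<tau>])
  qed
  show ?thesis
    unfolding unique_trace_property_def
  proof (rule ex1I)
    show "tracial_state_on (reduced_twisted_cstar \<sigma>)
        (restrict vacuum_coeff (reduced_twisted_cstar \<sigma>))"
      by (rule canonical_trace[OF assms(1)])
    then show "\<tau> = restrict vacuum_coeff (reduced_twisted_cstar \<sigma>)"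
      if "tracial_state_on (reduced_twisted_cstar \<sigma>) \<tau>" for \<tau>
      using that zero by (metis tracial_state_eqI[OF assms(1)])
  qed
qed

end
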